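(* There exists a non-trivial probability measure $d\mu(\zeta)=\tilde w(\zeta)\,d\sigma(\zeta)$ on $\partial\mathbb{B}^2$, absolutely continuous with respect to $\sigma$, whose Verblunsky coefficients $(\gamma_{\alpha,\beta})_{\alpha,\beta\in\mathbb{N}_0^2}$ satisfy $$\prod_{\alpha\in\mathbb{N}_0^2}(1-|\gamma_{0,\alpha}|^2)\ne\exp\left(\int_{\partial\mathbb{B}^2}\log(\tilde w(\zeta))\,d\sigma(\zeta)\right).$$
   Context: $\partial\mathbb{B}^2$ is the unit sphere of $\mathbb{C}^2$ and $\sigma$ the rotation-invariant Lebesgue probability measure on it. Conventions: $\log 0=-\infty$, $\exp(-\infty)=0$. Shortlex order $\prec$ on $\mathbb{N}_0^2$: $\alpha\prec\beta$ if $|\alpha|<|\beta|$ (where $|\alpha|=\alpha_1+\alpha_2$), or if $|\alpha|=|\beta|$ and $\alpha_i>\beta_i$ at the first index where they differ. Infinite products over $\mathbb{N}_0^2$ are limits of partial products in this order. Let $K(\alpha,\beta)=\int_{\partial\mathbb{B}^2}\zeta^\alpha\overline{\zeta}^\beta d\mu$. $\mu$ is non-trivial if $[K(\alpha',\beta')]_{0\preceq\alpha',\beta'\preceq\alpha}$ is invertible for every $\alpha$. Verblunsky coefficients of $\mu$: for $\alpha\prec\beta$ let $S=\{\delta:\alpha\prec\delta\prec\beta\}$, $M=[K(\delta,\delta')]_{\delta,\delta'\in S}$, $u=[K(\alpha,\delta)]_{\delta\in S}$ (row), $v=[K(\delta,\beta)]_{\delta\in S}$ (column), and $$\gamma_{\alpha,\beta}=\frac{K(\alpha,\beta)-uM^{-1}v}{\sqrt{K(\alpha,\alpha)-uM^{-1}u^*}\,\sqrt{K(\beta,\beta)-v^*M^{-1}v}},$$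 where terms involving $M$ are omitted if $S=\emptyset$; $\gamma_{\alpha,\alpha}=0$, $\gamma_{\beta,\alpha}=\overline{\gamma_{\alpha,\beta}}$. *)

theory Defs
  imports
    "HOL-Probability.Probability"
    "HOL-Library.Nat_Bijection"
    "Jordan_Normal_Form.Gauss_Jordan_Elimination"
begin

section \<open>The rotation-invariant probability measure on the unit sphere of \<open>\<complex>\<^sup>2\<close>\<close>

text \<open>
  Normalised Lebesgue measure of the unit ball, pushed forward along \<open>x \<mapsto> x / \<bar>x\<bar>\<close>.
  The product type \<open>complex \<times> complex\<close> carries the Euclidean norm.
\<close>

definition sphere_measure :: "(complex \<times> complex) measure" where
  "sphere_measure =
     restrict_space (distr (uniform_measure lborel (ball 0 1)) borel sgn) (sphere 0 1)"

lemma emeasure_lborel_unit_ball: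
  "emeasure lborel (ball (0::'a::euclidean_space) 1) \<noteq> 0"
  "emeasure lborel (ball (0::'a::euclidean_space) 1) \<noteq> \<infinity>"
  using emeasure_ball[of 1 "0::'a"] unit_ball_vol_pos[of "real DIM('a)"]
  by (simp_all add: less_imp_neq[symmetric])

lemma lborel_unique_translation:
  fixes N :: "'a::euclidean_space measure"
  assumes sets [measurable_cong, simp]: "sets N = sets borel" and fin: "sigma_finite_measure N"
    and transl: "\<And>a. distr N borel (\<lambda>x. a + x) = N"
    and ball: "emeasure N (ball 0 1) = emeasure lborel (ball (0::'a) 1)"
  shows "N = lborel"
proof (rule measure_eqI)
  show "sets N = sets lborel" by simp
next
  fix A assume "A \<in> sets N"
  then have A [measurable]: "A \<in> sets borel" by simp
  interpret N: sigma_finite_measure N by (rule fin)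
  interpret P: pair_sigma_finite lborel N ..
  let ?B = "ball (0::'a) 1"
  have shiftL: "(\<integral>\<^sup>+x. f (x + y) \<partial>lborel) = (\<integral>\<^sup>+x. f x \<partial>lborel)"
    if [measurable]: "f \<in> borel_measurable borel" for f :: "'a \<Rightarrow> ennreal" and y
  proof -
    have "(\<integral>\<^sup>+x. f x \<partial>lborel) = (\<integral>\<^sup>+x. f x \<partial>density (distr lborel borel (\<lambda>x. y + 1 *\<^sub>R x)) (\<lambda>_. ennreal (\<bar>1\<bar>^DIM('a))))"
      by (subst lborel_affine[of 1 y]) auto
    also have "\<dots> = (\<integral>\<^sup>+x. f (x + y) \<partial>lborel)"
      by (simp add: nn_integral_distr add.commute density_1)
    finally show ?thesis by simp
  qed
  have reflL: "(\<integral>\<^sup>+x. f (y - x) \<partial>lborel) = (\<integral>\<^sup>+x. f x \<partial>lborel)"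
    if [measurable]: "f \<in> borel_measurable borel" for f :: "'a \<Rightarrow> ennreal" and y
  proof -
    have "(\<integral>\<^sup>+x. f x \<partial>lborel) = (\<integral>\<^sup>+x. f x \<partial>density (distr lborel borel (\<lambda>x. y + (-1) *\<^sub>R x)) (\<lambda>_. ennreal (\<bar>-1\<bar>^DIM('a))))"
      by (subst lborel_affine[of "-1" y]) auto
    also have "\<dots> = (\<integral>\<^sup>+x. f (y - x) \<partial>lborel)"
      by (simp add: nn_integral_distr density_1)
    finally show ?thesis by simp
  qed
  have shiftN: "(\<integral>\<^sup>+x. f x \<partial>N) = (\<integral>\<^sup>+x. f (a + x) \<partial>N)"
    if [measurable]: "f \<in> borel_measurable borel" for f :: "'a \<Rightarrow> ennreal" and a
  proof -
    have "(\<integral>\<^sup>+x. f x \<partial>N) = (\<integral>\<^sup>+x. f x \<partial>distr N borel (\<lambda>x. a + x))" by (simp add: transl)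
    also have "\<dots> = (\<integral>\<^sup>+x. f (a + x) \<partial>N)" by (rule nn_integral_distr) auto
    finally show ?thesis .
  qed
  have B [measurable]: "?B \<in> sets borel" by simp
  have "emeasure N ?B * emeasure lborel A
      = (\<integral>\<^sup>+y. (\<integral>\<^sup>+x. indicator ?B y * indicator A (x + y) \<partial>lborel) \<partial>N)"
    by (simp add: nn_integral_cmult shiftL nn_integral_multc)
  also have "\<dots> = (\<integral>\<^sup>+x. (\<integral>\<^sup>+y. indicator ?B y * indicator A (x + y) \<partial>N) \<partial>lborel)"
    by (rule P.Fubini') simp
  also have "\<dots> = (\<integral>\<^sup>+x. (\<integral>\<^sup>+y. indicator ?B (y - x) * indicator A y \<partial>N) \<partial>lborel)"
  proof (rule nn_integral_cong)
    fix x :: 'a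
    show "(\<integral>\<^sup>+y. indicator ?B y * indicator A (x + y) \<partial>N)
        = (\<integral>\<^sup>+y. indicator ?B (y - x) * indicator A y \<partial>N)"
      using shiftN[of "\<lambda>y. indicator ?B (y - x) * indicator A y" x] by simp
  qed
  also have "\<dots> = (\<integral>\<^sup>+y. (\<integral>\<^sup>+x. indicator ?B (y - x) * indicator A y \<partial>lborel) \<partial>N)"
    by (rule P.Fubini'[symmetric]) simp
  also have "\<dots> = emeasure lborel ?B * emeasure N A"
    by (simp add: nn_integral_multc nn_integral_cmult reflL)
  finally have eq: "emeasure lborel ?B * emeasure lborel A = emeasure lborel ?B * emeasure N A"
    by (simp only: ball)
  have "emeasure lborel ?B \<noteq> 0" "emeasure lborel ?B \<noteq> \<infinity>"
    using emeasure_lborel_unit_ball by auto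
  then show "emeasure N A = emeasure lborel A"
    using eq by (simp add: ennreal_mult_cancel_left)
qed


lemma distr_lborel_orthogonal:
  fixes U :: "'a::euclidean_space \<Rightarrow> 'a"
  assumes U: "orthogonal_transformation U"
  shows "distr lborel borel U = lborel"
proof (rule lborel_unique_translation)
  have lin: "linear U" using U by (simp add: orthogonal_transformation_def)
  have [measurable]: "U \<in> borel_measurable borel"
    by (intro borel_measurable_continuous_onI linear_continuous_on linear_linear[THEN iffD2, OF lin])
  show "sets (distr lborel borel U) = sets borel" by simp
  obtain V where V: "orthogonal_transformation V" "\<And>x. V (U x) = x" "\<And>x. U (V x) = x"
    using orthogonal_transformation_surj[OF U] orthogonal_transformation_inj[OF U]
      orthogonal_transformation_inv[OF U]
    by (metis inv_f_f surj_f_inv_f)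
  have [measurable]: "V \<in> borel_measurable borel"
    using V(1) by (intro borel_measurable_continuous_onI linear_continuous_on)
      (simp add: orthogonal_transformation_def linear_linear)
  have shift: "distr lborel borel (\<lambda>x. a + x) = lborel" for a :: 'a
    using lborel_affine[of 1 a] by (simp add: density_1)
  show "distr (distr lborel borel U) borel (\<lambda>x. a + x) = distr lborel borel U" for a
  proof -
    have "distr (distr lborel borel U) borel (\<lambda>x. a + x) = distr lborel borel (\<lambda>x. U (V a + x))"
      by (simp add: distr_distr comp_def linear_add[OF lin] V)
    also have "\<dots> = distr (distr lborel borel (\<lambda>x. V a + x)) borel U"
      by (simp add: distr_distr comp_def)
    finally show ?thesis by (simp only: shift)
  qed
  have ball: "emeasure (distr lborel borel U) (ball (0::'a) r) = emeasure lborel (ball (0::'a) r)" for r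
  proof -
    have "U -` ball 0 r = ball 0 r"
      using orthogonal_transformation_norm[OF U] by auto
    then show ?thesis by (simp add: emeasure_distr)
  qed
  show "emeasure (distr lborel borel U) (ball (0::'a) 1) = emeasure lborel (ball (0::'a) 1)"
    by (rule ball)
  show "sigma_finite_measure (distr lborel borel U)"
  proof
    show "\<exists>A. countable A \<and> A \<subseteq> sets (distr lborel borel U) \<and> \<Union> A = space (distr lborel borel U) \<and>
        (\<forall>a\<in>A. emeasure (distr lborel borel U) a \<noteq> \<infinity>)"
    proof (intro exI conjI ballI)
      show "\<Union> (range (\<lambda>n::nat. ball (0::'a) (real n))) = space (distr lborel borel U)"
        by (auto intro: reals_Archimedean2)
    qed (use emeasure_lborel_ball_finite[where ?'a = 'a] in \<open>auto simp: ball order.strict_iff_order\<close>)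
  qed
qed

lemma space_sphere_measure [simp]: "space sphere_measure = sphere 0 1"
  by (simp add: sphere_measure_def space_restrict_space)

lemma sets_sphere_measure [simp, measurable_cong]:
  "sets sphere_measure = sets (restrict_space borel (sphere 0 1))"
  by (simp add: sphere_measure_def sets_restrict_space)

lemma sgn_measurable_prod [measurable]: "(sgn :: complex \<times> complex \<Rightarrow> _) \<in> borel_measurable borel"
  unfolding sgn_div_norm[abs_def] by measurable

lemma prob_space_sphere_measure: "prob_space sphere_measure"
proof -
  let ?B = "ball (0 :: complex \<times> complex) 1"
  let ?Q = "uniform_measure lborel ?B"
  interpret Q: prob_space ?Q
    using emeasure_lborel_unit_ball[where ?'a = "complex \<times> complex"]
    by (intro prob_space_uniform_measure) auto
  interpret D: prob_space "distr ?Q borel sgn"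
    by (rule Q.prob_space_distr) simp
  have "AE x in lborel. (x :: complex \<times> complex) \<noteq> 0"
    by (rule AE_lborel_singleton)
  then have "AE x in ?Q. x \<noteq> 0"
    by (intro AE_uniform_measureI) auto
  then have "AE x in ?Q. sgn x \<in> sphere 0 1"
    by (rule AE_mp) (auto simp: norm_sgn)
  then have "AE x in distr ?Q borel sgn. x \<in> sphere 0 1"
    by (subst AE_distr_iff) auto
  then have "emeasure (distr ?Q borel sgn) (sphere 0 1) = 1"
    by (subst D.emeasure_eq_1_AE) auto
  then show "prob_space sphere_measure"
    by (intro prob_spaceI)
       (simp add: sphere_measure_def emeasure_restrict_space space_restrict_space)
qed

lemma sphere_measure_rotation_invariant:
  assumes U: "orthogonal_transformation U"
  shows "distr sphere_measure sphere_measure U = sphere_measure"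
proof (rule measure_eqI)
  fix A assume "A \<in> sets (distr sphere_measure sphere_measure U)"
  then have A: "A \<in> sets borel" "A \<subseteq> sphere 0 1"
    by (auto simp: sets_restrict_space)
  let ?B = "ball (0 :: complex \<times> complex) 1"
  have lin: "linear U" using U by (simp add: orthogonal_transformation_def)
  have nU: "norm (U x) = norm x" for x
    using orthogonal_transformation_norm[OF U] .
  have Um [measurable]: "U \<in> borel_measurable borel"
    by (intro borel_measurable_continuous_onI linear_continuous_on linear_linear[THEN iffD2, OF lin])
  have Us: "U \<in> measurable sphere_measure sphere_measure"
    unfolding measurable_cong_sets[OF sets_sphere_measure sets_sphere_measure]
    by (intro measurable_restrict_space3) (auto simp: nU)
  have sgnU: "sgn (U x) = U (sgn x)" for x
    by (simp add: sgn_div_norm nU linear_cmul[OF lin])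
  have em: "emeasure sphere_measure X = emeasure lborel (?B \<inter> sgn -` X) / emeasure lborel ?B"
    if "X \<in> sets borel" "X \<subseteq> sphere 0 1" for X
    using that measurable_sets_borel[OF sgn_measurable_prod, of X] unfolding sphere_measure_def
    by (simp add: emeasure_restrict_space emeasure_distr)
  have pre: "U -` A \<inter> sphere 0 1 = U -` A"
  proof -
    have "x \<in> sphere 0 1" if "U x \<in> A" for x
      using A(2) that nU[of x] by auto
    then show ?thesis by blast
  qed
  have "emeasure (distr sphere_measure sphere_measure U) A = emeasure sphere_measure (U -` A)"
    using A by (subst emeasure_distr[OF Us]) (auto simp: sets_restrict_space pre)
  also have "\<dots> = emeasure lborel (?B \<inter> sgn -` (U -` A)) / emeasure lborel ?B"
    using A pre by (intro em measurable_sets_borel[OF Um]) auto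
  also have "?B \<inter> sgn -` (U -` A) = U -` (?B \<inter> sgn -` A)"
  proof (rule Set.set_eqI)
    show "x \<in> ?B \<inter> sgn -` (U -` A) \<longleftrightarrow> x \<in> U -` (?B \<inter> sgn -` A)" for x
      by (simp add: sgnU nU)
  qed
  also have "emeasure lborel (U -` (?B \<inter> sgn -` A)) = emeasure (distr lborel borel U) (?B \<inter> sgn -` A)"
    using A by (subst emeasure_distr) (auto intro!: sets.Int measurable_sets_borel[OF sgn_measurable_prod])
  also have "\<dots> = emeasure lborel (?B \<inter> sgn -` A)"
    by (simp only: distr_lborel_orthogonal[OF U])
  also have "\<dots> / emeasure lborel ?B = emeasure sphere_measure A"
    using A by (simp add: em)
  finally show "emeasure (distr sphere_measure sphere_measure U) A = emeasure sphere_measure A" .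
qed simp


section \<open>Shortlex order on \<open>\<nat>\<^sub>0\<^sup>2\<close>\<close>

definition shortlex_less :: "nat \<times> nat \<Rightarrow> nat \<times> nat \<Rightarrow> bool" where
  "shortlex_less \<alpha> \<beta> \<longleftrightarrow>
     fst \<alpha> + snd \<alpha> < fst \<beta> + snd \<beta> \<or>
     fst \<alpha> + snd \<alpha> = fst \<beta> + snd \<beta> \<and>
       (fst \<alpha> > fst \<beta> \<or> fst \<alpha> = fst \<beta> \<and> snd \<alpha> > snd \<beta>)"

text \<open>
  The library's diagonal enumeration runs through each diagonal with increasing first component;
  swapping the components gives the increasing enumeration
  \<open>(0,0), (1,0), (0,1), (2,0), (1,1), (0,2), \<dots>\<close> of the shortlex order.
\<close>

definition shortlex_nth :: "nat \<Rightarrow> nat \<times> nat" where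
  "shortlex_nth n = prod.swap (prod_decode n)"

definition shortlex_rank :: "nat \<times> nat \<Rightarrow> nat" where
  "shortlex_rank \<alpha> = prod_encode (prod.swap \<alpha>)"

lemma shortlex_nth_rank [simp]: "shortlex_nth (shortlex_rank \<alpha>) = \<alpha>"
  by (simp add: shortlex_nth_def shortlex_rank_def)

lemma shortlex_rank_nth [simp]: "shortlex_rank (shortlex_nth n) = n"
  by (simp add: shortlex_nth_def shortlex_rank_def)

lemma triangle_mono_strict: "a < b \<Longrightarrow> triangle a + a < triangle b"
proof (induction b)
  case (Suc b)
  then show ?case by (cases "a = b") auto
qed simp

lemma shortlex_rank_less_iff: "shortlex_rank \<alpha> < shortlex_rank \<beta> \<longleftrightarrow> shortlex_less \<alpha> \<beta>"
proof -
  obtain a b c d where [simp]: "\<alpha> = (a, b)" "\<beta> = (c, d)" by (cases \<alpha>, cases \<beta>)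
  consider "a + b < c + d" | "a + b = c + d" | "a + b > c + d" by linarith
  then show ?thesis
  proof cases
    case 1
    then show ?thesis
      using triangle_mono_strict[OF 1]
      by (auto simp: shortlex_rank_def prod_encode_def shortlex_less_def add.commute)
  next
    case 2
    then have "b + a = d + c" by simp
    then show ?thesis
      by (auto simp: shortlex_rank_def prod_encode_def shortlex_less_def)
  next
    case 3
    then show ?thesis
      using triangle_mono_strict[OF 3]
      by (auto simp: shortlex_rank_def prod_encode_def shortlex_less_def add.commute)
  qed
qed

lemma shortlex_less_nth_iff: "shortlex_less (shortlex_nth m) (shortlex_nth n) \<longleftrightarrow> m < n"
  by (simp flip: shortlex_rank_less_iff)

definition shortlex_upto :: "nat \<times> nat \<Rightarrow> (nat \<times> nat) list" where
  "shortlex_upto \<alpha> = map shortlex_nth [0..<Suc (shortlex_rank \<alpha>)]"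

definition shortlex_between :: "nat \<times> nat \<Rightarrow> nat \<times> nat \<Rightarrow> (nat \<times> nat) list" where
  "shortlex_between \<alpha> \<beta> = map shortlex_nth [Suc (shortlex_rank \<alpha>)..<shortlex_rank \<beta>]"

lemma shortlex_upto:
  "set (shortlex_upto \<alpha>) = {\<delta>. \<delta> = \<alpha> \<or> shortlex_less \<delta> \<alpha>}"
  "sorted_wrt shortlex_less (shortlex_upto \<alpha>)"
proof -
  have "\<delta> \<in> set (shortlex_upto \<alpha>) \<longleftrightarrow> shortlex_rank \<delta> \<le> shortlex_rank \<alpha>" for \<delta>
    unfolding shortlex_upto_def
    by (auto simp: image_iff less_Suc_eq_le simp del: upt_Suc intro!: bexI[of _ "shortlex_rank \<delta>"])
  moreover have "shortlex_rank \<delta> = shortlex_rank \<alpha> \<longleftrightarrow> \<delta> = \<alpha>" for \<delta>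
    by (metis shortlex_nth_rank)
  moreover have "shortlex_rank \<delta> \<le> shortlex_rank \<alpha> \<longleftrightarrow>
      shortlex_rank \<delta> = shortlex_rank \<alpha> \<or> shortlex_less \<delta> \<alpha>" for \<delta>
    unfolding le_less shortlex_rank_less_iff by blast
  ultimately show "set (shortlex_upto \<alpha>) = {\<delta>. \<delta> = \<alpha> \<or> shortlex_less \<delta> \<alpha>}"
    by auto
  show "sorted_wrt shortlex_less (shortlex_upto \<alpha>)"
    unfolding shortlex_upto_def sorted_wrt_map shortlex_less_nth_iff by (rule sorted_wrt_upt)
qed

lemma shortlex_between:
  "set (shortlex_between \<alpha> \<beta>) = {\<delta>. shortlex_less \<alpha> \<delta> \<and> shortlex_less \<delta> \<beta>}"
  "sorted_wrt shortlex_less (shortlex_between \<alpha> \<beta>)"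
proof -
  have "\<delta> \<in> set (shortlex_between \<alpha> \<beta>) \<longleftrightarrow>
      shortlex_rank \<alpha> < shortlex_rank \<delta> \<and> shortlex_rank \<delta> < shortlex_rank \<beta>" for \<delta>
    unfolding shortlex_between_def
    by (auto simp: image_iff Suc_le_eq intro!: bexI[of _ "shortlex_rank \<delta>"])
  then show "set (shortlex_between \<alpha> \<beta>) = {\<delta>. shortlex_less \<alpha> \<delta> \<and> shortlex_less \<delta> \<beta>}"
    by (auto simp: shortlex_rank_less_iff)
  show "sorted_wrt shortlex_less (shortlex_between \<alpha> \<beta>)"
    unfolding shortlex_between_def sorted_wrt_map shortlex_less_nth_iff by (rule sorted_wrt_upt)
qed

text \<open>
  Unlike the library's \<open>has_prod\<close>, this is the plain limit of the partial products, which may be 0.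
\<close>

definition has_shortlex_prod :: "(nat \<times> nat \<Rightarrow> real) \<Rightarrow> real \<Rightarrow> bool" where
  "has_shortlex_prod f L \<longleftrightarrow> (\<lambda>n. \<Prod>k<n. f (shortlex_nth k)) \<longlonglongrightarrow> L"


section \<open>Moments and Verblunsky coefficients\<close>

definition cmonom :: "nat \<times> nat \<Rightarrow> complex \<times> complex \<Rightarrow> complex" where
  "cmonom \<alpha> \<zeta> = fst \<zeta> ^ fst \<alpha> * snd \<zeta> ^ snd \<alpha>"

definition moment ::
    "(complex \<times> complex) measure \<Rightarrow> nat \<times> nat \<Rightarrow> nat \<times> nat \<Rightarrow> complex" where
  "moment \<mu> \<alpha> \<beta> = (\<integral>\<zeta>. cmonom \<alpha> \<zeta> * cnj (cmonom \<beta> \<zeta>) \<partial>\<mu>)"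

definition kernel_mat :: "('i \<Rightarrow> 'i \<Rightarrow> 'a) \<Rightarrow> 'i list \<Rightarrow> 'a mat" where
  "kernel_mat K xs = Matrix.mat (length xs) (length xs) (\<lambda>(i, j). K (xs ! i) (xs ! j))"

definition nontrivial_measure :: "(complex \<times> complex) measure \<Rightarrow> bool" where
  "nontrivial_measure \<mu> \<longleftrightarrow> (\<forall>\<alpha>. invertible_mat (kernel_mat (moment \<mu>) (shortlex_upto \<alpha>)))"

text \<open>
  In the formula below \<open>N = M\<^sup>-\<^sup>1\<close>. If no index lies strictly between \<open>\<alpha>\<close> and \<open>\<beta>\<close>, then \<open>M\<close> is the
  \<open>0 \<times> 0\<close> matrix and the terms containing \<open>N\<close> are empty sums, hence 0.
  For a non-trivial measure \<open>M\<close> is invertible, and both radicands are positive reals, on which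
  \<^const>\<open>csqrt\<close> is the usual square root.
\<close>

definition verblunsky_upper ::
    "(nat \<times> nat \<Rightarrow> nat \<times> nat \<Rightarrow> complex) \<Rightarrow> nat \<times> nat \<Rightarrow> nat \<times> nat \<Rightarrow> complex" where
  "verblunsky_upper K \<alpha> \<beta> =
     (let S = shortlex_between \<alpha> \<beta>;
          N = the (mat_inverse (kernel_mat K S));
          u = vec_of_list (map (\<lambda>\<delta>. K \<alpha> \<delta>) S);
          v = vec_of_list (map (\<lambda>\<delta>. K \<delta> \<beta>) S)
      in (K \<alpha> \<beta> - scalar_prod u (N *\<^sub>v v)) /
         (csqrt (K \<alpha> \<alpha> - scalar_prod u (N *\<^sub>v conjugate u)) *
          csqrt (K \<beta> \<beta> - scalar_prod (conjugate v) (N *\<^sub>v v))))"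

definition verblunsky ::
    "(complex \<times> complex) measure \<Rightarrow> nat \<times> nat \<Rightarrow> nat \<times> nat \<Rightarrow> complex" where
  "verblunsky \<mu> \<alpha> \<beta> =
     (if shortlex_less \<alpha> \<beta> then verblunsky_upper (moment \<mu>) \<alpha> \<beta>
      else if shortlex_less \<beta> \<alpha> then cnj (verblunsky_upper (moment \<mu>) \<beta> \<alpha>)
      else 0)"

lemma mat_inverse_kernel_mat:
  assumes "invertible_mat (kernel_mat K xs :: 'a::field mat)"
  obtains N where "mat_inverse (kernel_mat K xs) = Some N"
    "N \<in> carrier_mat (length xs) (length xs)"
    "kernel_mat K xs * N = 1\<^sub>m (length xs)" "N * kernel_mat K xs = 1\<^sub>m (length xs)"
proof -
  let ?n = "length xs" and ?M = "kernel_mat K xs"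
  have M: "?M \<in> carrier_mat ?n ?n" by (simp add: kernel_mat_def)
  from assms obtain B where B: "inverts_mat ?M B" "inverts_mat B ?M"
    by (auto simp: invertible_mat_def)
  have MB: "?M * B = 1\<^sub>m ?n" and BM: "B * ?M = 1\<^sub>m (dim_row B)"
    using B M by (auto simp: inverts_mat_def)
  have "dim_col (?M * B) = dim_col B" "dim_col (B * ?M) = ?n" using M by auto
  then have Bc: "B \<in> carrier_mat ?n ?n" using MB BM by (auto intro: carrier_matI)
  then have "?M \<in> Units (ring_mat TYPE('a) ?n ())"
    using M MB BM by (auto simp: Units_def ring_mat_simps intro!: bexI[of _ B])
  then have "mat_inverse ?M \<noteq> None" using mat_inverse(1)[OF M] by metis
  then obtain N where "mat_inverse ?M = Some N" by blast
  with mat_inverse(2)[OF M this] show thesis by (intro that) auto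
qed


section \<open>Geometric mean with \<open>log 0 = -\<infinity>\<close> and \<open>exp (-\<infinity>) = 0\<close>\<close>

definition ereal_ln :: "real \<Rightarrow> ereal" where
  "ereal_ln x = (if x = 0 then -\<infinity> else ereal (ln x))"

definition ereal_exp :: "ereal \<Rightarrow> ereal" where
  "ereal_exp x = (case x of ereal r \<Rightarrow> ereal (exp r) | PInfty \<Rightarrow> \<infinity> | MInfty \<Rightarrow> 0)"

text \<open>
  Integral of an extended real function as positive part minus negative part. For the logarithm of a
  probability density the positive part is finite because \<open>log x \<le> x\<close>, so the difference is well
  defined in \<open>[-\<infinity>, \<infinity>)\<close>.
\<close>

definition ereal_integral :: "'a measure \<Rightarrow> ('a \<Rightarrow> ereal) \<Rightarrow> ereal" where
  "ereal_integral M f =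
     enn2ereal (\<integral>\<^sup>+x. e2ennreal (f x) \<partial>M) - enn2ereal (\<integral>\<^sup>+x. e2ennreal (- f x) \<partial>M)"

end

theory Submission
  imports Defs
begin

text \<open>
  In contrast to the circle, the sphere of \<open>\<complex>\<^sup>2\<close> carries non-constant weights that the off-diagonal
  moments of holomorphic monomials cannot see: those depending on \<open>\<bar>\<zeta>\<^sub>1\<bar>\<close> and \<open>\<bar>\<zeta>\<^sub>2\<bar>\<close> alone. For such a weight
  the rotations \<open>(\<zeta>\<^sub>1, \<zeta>\<^sub>2) \<mapsto> (a \<zeta>\<^sub>1, b \<zeta>\<^sub>2)\<close> with \<open>\<bar>a\<bar> = \<bar>b\<bar> = 1\<close> preserve \<open>w d\<sigma>\<close>, so distinct monomials are
  orthogonal (\<open>moment_off_diagonal_eq_0\<close>). A diagonal moment matrix with non-zero diagonal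
  (\<open>moment_diagonal_ne_0\<close>) is invertible, and all its Verblunsky coefficients vanish
  (\<open>verblunsky_upper_diagonal_kernel\<close>). Hence the product is 1 for every weight of this kind, whereas
  by Jensen's inequality the geometric mean of a probability density is 1 only if the density is
  constant.

  The weight used here is the normalised indicator of \<open>{0 < \<bar>\<zeta>\<^sub>1\<bar> < \<bar>\<zeta>\<^sub>2\<bar>}\<close>. It is 0 on the set
  \<open>{\<bar>\<zeta>\<^sub>2\<bar> < \<bar>\<zeta>\<^sub>1\<bar>}\<close>, which has positive measure (\<open>emeasure_sphere_measure_open_cone_pos\<close>), so its logarithm has
  integral \<open>-\<infinity>\<close> (\<open>ereal_integral_ln_eq_minus_infinity\<close>). The geometric mean is therefore 0, while the product is 1.
\<close>

section \<open>Weights invariant under the torus\<close>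

definition torus_rotation :: "complex \<Rightarrow> complex \<Rightarrow> complex \<times> complex \<Rightarrow> complex \<times> complex" where
  "torus_rotation a b \<zeta> = (a * fst \<zeta>, b * snd \<zeta>)"

definition torus_invariant :: "(complex \<times> complex \<Rightarrow> 'a) \<Rightarrow> bool" where
  "torus_invariant f \<longleftrightarrow>
     (\<forall>a b \<zeta>. cmod a = 1 \<longrightarrow> cmod b = 1 \<longrightarrow> f (torus_rotation a b \<zeta>) = f \<zeta>)"

lemma orthogonal_transformation_torus_rotation:
  assumes "cmod a = 1" "cmod b = 1"
  shows "orthogonal_transformation (torus_rotation a b)"
  unfolding orthogonal_transformation
proof
  show "linear (torus_rotation a b)"
    by (rule linearI) (auto simp: torus_rotation_def algebra_simps)
  show "\<forall>\<zeta>. norm (torus_rotation a b \<zeta>) = norm \<zeta>"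
    using assms by (simp add: torus_rotation_def norm_prod_def norm_mult)
qed

lemma cmonom_torus_rotation:
  "cmonom \<alpha> (torus_rotation a b \<zeta>) = a ^ fst \<alpha> * b ^ snd \<alpha> * cmonom \<alpha> \<zeta>"
  by (simp add: cmonom_def torus_rotation_def power_mult_distrib)

lemma continuous_on_cmonom [continuous_intros]: "continuous_on A (cmonom \<alpha>)"
  unfolding cmonom_def[abs_def] by (intro continuous_intros)

lemma borel_measurable_sphere_measureI:
  "f \<in> borel_measurable borel \<Longrightarrow> f \<in> borel_measurable sphere_measure"
  unfolding measurable_cong_sets[OF sets_sphere_measure refl]
  by (rule measurable_restrict_space1)

text \<open>Separates the characters \<open>a \<mapsto> a\<^sup>m\<close> and \<open>a \<mapsto> a\<^sup>n\<close> of the circle, which makes monomials orthogonal.\<close>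

lemma exists_unit_power_ne:
  assumes "m \<noteq> n"
  shows "\<exists>a. cmod a = 1 \<and> a ^ m * cnj (a ^ n) \<noteq> 1"
proof -
  \<comment> \<open>The angle is chosen so that the product of powers becomes \<open>cis pi = -1\<close>.\<close>
  define t where "t = pi / (real m - real n)"
  have "cis t ^ m * cnj (cis t ^ n) = cis ((real m - real n) * t)"
    by (simp add: Complex.DeMoivre cis_cnj cis_mult algebra_simps)
  also have "(real m - real n) * t = pi"
    using assms by (simp add: t_def)
  finally show ?thesis
    by (intro exI[of _ "cis t"]) simp
qed

text \<open>
  A torus rotation leaves the integral unchanged but multiplies the integrand by a unimodular
  constant. Since \<open>\<alpha>\<close> and \<open>\<beta>\<close> differ in some component, rotating that coordinate alone can make the
  constant different from 1, and then the integral must be 0.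
\<close>

lemma moment_off_diagonal_eq_0:
  assumes w: "w \<in> borel_measurable sphere_measure" "\<forall>\<zeta>\<in>sphere 0 1. 0 \<le> w \<zeta>"
    and inv: "torus_invariant w" and ne: "\<alpha> \<noteq> \<beta>"
  shows "moment (density sphere_measure (\<lambda>\<zeta>. ennreal (w \<zeta>))) \<alpha> \<beta> = 0"
proof -
  define f where "f = (\<lambda>\<zeta>. w \<zeta> *\<^sub>R (cmonom \<alpha> \<zeta> * cnj (cmonom \<beta> \<zeta>)))"
  let ?I = "\<integral>\<zeta>. f \<zeta> \<partial>sphere_measure"
  have [measurable]: "(\<lambda>\<zeta>. cmonom \<alpha> \<zeta> * cnj (cmonom \<beta> \<zeta>)) \<in> borel_measurable sphere_measure"
    by (intro borel_measurable_sphere_measureI borel_measurable_continuous_onI continuous_intros)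
  have fm: "f \<in> borel_measurable sphere_measure"
    using w(1) unfolding f_def by measurable
  have I: "moment (density sphere_measure (\<lambda>\<zeta>. ennreal (w \<zeta>))) \<alpha> \<beta> = ?I"
    unfolding moment_def f_def using w by (intro integral_density) auto
  have factor: "?I = a ^ fst \<alpha> * b ^ snd \<alpha> * cnj (a ^ fst \<beta> * b ^ snd \<beta>) * ?I"
    if ab: "cmod a = 1" "cmod b = 1" for a b
  proof -
    note U = orthogonal_transformation_torus_rotation[OF ab]
    have Um: "torus_rotation a b \<in> measurable sphere_measure sphere_measure"
      unfolding measurable_cong_sets[OF sets_sphere_measure sets_sphere_measure]
      using orthogonal_transformation_norm[OF U] linear_linear[THEN iffD2, OF orthogonal_transformation_linear[OF U]]
      by (intro measurable_restrict_space3 borel_measurable_continuous_onI linear_continuous_on) auto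
    have "?I = (\<integral>\<zeta>. f \<zeta> \<partial>distr sphere_measure sphere_measure (torus_rotation a b))"
      by (simp only: sphere_measure_rotation_invariant[OF U])
    also have "\<dots> = (\<integral>\<zeta>. f (torus_rotation a b \<zeta>) \<partial>sphere_measure)"
      by (rule integral_distr[OF Um fm])
    also have "(\<lambda>\<zeta>. f (torus_rotation a b \<zeta>)) = (\<lambda>\<zeta>.
        a ^ fst \<alpha> * b ^ snd \<alpha> * cnj (a ^ fst \<beta> * b ^ snd \<beta>) * f \<zeta>)"
    proof
      fix \<zeta>
      have "w (torus_rotation a b \<zeta>) = w \<zeta>"
        using inv ab unfolding torus_invariant_def by blast
      then show "f (torus_rotation a b \<zeta>) =
          a ^ fst \<alpha> * b ^ snd \<alpha> * cnj (a ^ fst \<beta> * b ^ snd \<beta>) * f \<zeta>"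
        unfolding f_def cmonom_torus_rotation by (simp add: algebra_simps)
    qed
    finally show ?thesis by simp
  qed
  have "?I = 0"
  proof (cases "fst \<alpha> = fst \<beta>")
    case False
    then obtain a where "cmod a = 1" "a ^ fst \<alpha> * cnj (a ^ fst \<beta>) \<noteq> 1"
      using exists_unit_power_ne by blast
    then show ?thesis using factor[of a 1] by auto
  next
    case True
    with ne have "snd \<alpha> \<noteq> snd \<beta>" by (simp add: prod_eq_iff)
    then obtain b where "cmod b = 1" "b ^ snd \<alpha> * cnj (b ^ snd \<beta>) \<noteq> 1"
      using exists_unit_power_ne by blast
    then show ?thesis using factor[of 1 b] by auto
  qed
  with I show ?thesis by simp
qed

text \<open>
  The moment is the integral of \<open>\<bar>\<zeta>\<^sup>\<alpha>\<bar>\<^sup>2\<close>, which vanishes only on the coordinate axes. Keeping the axes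
  out of the set where the weight is positive makes the integrand positive almost everywhere without
  having to know that the axes are null sets.
\<close>

lemma moment_diagonal_ne_0:
  assumes w: "w \<in> borel_measurable sphere_measure"
    and prob: "prob_space (density sphere_measure (\<lambda>\<zeta>. ennreal (w \<zeta>)))"
    and supp: "\<And>\<zeta>. w \<zeta> > 0 \<Longrightarrow> fst \<zeta> \<noteq> 0 \<and> snd \<zeta> \<noteq> 0"
  shows "moment (density sphere_measure (\<lambda>\<zeta>. ennreal (w \<zeta>))) \<alpha> \<alpha> \<noteq> 0"
proof
  let ?\<mu> = "density sphere_measure (\<lambda>\<zeta>. ennreal (w \<zeta>))"
  interpret prob_space ?\<mu> by (rule prob)
  define g where "g \<zeta> = (cmod (cmonom \<alpha> \<zeta>))\<^sup>2" for \<zeta>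
  have "g \<in> borel_measurable borel"
    unfolding g_def by (intro borel_measurable_continuous_onI continuous_intros)
  then have gm: "g \<in> borel_measurable ?\<mu>"
    using borel_measurable_sphere_measureI by simp
  have "g \<zeta> \<le> 1" if "\<zeta> \<in> sphere 0 1" for \<zeta>
  proof -
    have "cmod (fst \<zeta>) \<le> 1" "cmod (snd \<zeta>) \<le> 1"
      using that norm_fst_le[of "fst \<zeta>" "snd \<zeta>"] norm_snd_le[of "snd \<zeta>" "fst \<zeta>"] by auto
    then show ?thesis
      unfolding g_def cmonom_def norm_mult norm_power
      by (intro power_le_one mult_le_one) auto
  qed
  then have "integrable ?\<mu> g"
    by (intro integrable_const_bound[where B = 1] gm AE_I2) (auto simp: g_def)
  moreover assume "moment ?\<mu> \<alpha> \<alpha> = 0"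
  then have "(\<integral>\<zeta>. complex_of_real (g \<zeta>) \<partial>?\<mu>) = 0"
    by (simp add: moment_def g_def flip: complex_norm_square of_real_power)
  then have "(\<integral>\<zeta>. g \<zeta> \<partial>?\<mu>) = 0"
    by (simp add: integral_complex_of_real)
  ultimately have "AE \<zeta> in ?\<mu>. g \<zeta> = 0"
    by (subst (asm) integral_nonneg_eq_0_iff_AE) (auto simp: g_def)
  moreover have "AE \<zeta> in ?\<mu>. g \<zeta> \<noteq> 0"
    using w supp by (subst AE_density) (auto simp: g_def cmonom_def)
  ultimately have "AE \<zeta> in ?\<mu>. False"
    by eventually_elim simp
  then show False
    by (simp add: AE_False)
qed


section \<open>Verblunsky coefficients of a diagonal kernel\<close>

lemma invertible_diagonal_kernel_mat:
  fixes K :: "'i \<Rightarrow> 'i \<Rightarrow> 'a::field"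
  assumes "distinct xs" and off: "\<And>x y. x \<noteq> y \<Longrightarrow> K x y = 0" and diag: "\<And>x. K x x \<noteq> 0"
  shows "invertible_mat (kernel_mat K xs)"
proof -
  let ?n = "length xs" and ?M = "kernel_mat K xs"
  define N where "N = Matrix.mat ?n ?n (\<lambda>(i, j). if i = j then inverse (K (xs ! i) (xs ! i)) else 0)"
  have ne: "K (xs ! i) (xs ! j) = 0" if "i < ?n" "j < ?n" "i \<noteq> j" for i j
    using that \<open>distinct xs\<close> by (intro off) (simp add: nth_eq_iff_index_eq)
  have "?M * N = 1\<^sub>m ?n"
    unfolding N_def kernel_mat_def using ne diag
    by (intro eq_matI) (auto simp: scalar_prod_def if_distrib cong: if_cong)
  moreover have "N * ?M = 1\<^sub>m ?n"
    unfolding N_def kernel_mat_def using ne diag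
    by (intro eq_matI) (auto simp: scalar_prod_def if_distrib[where f = "\<lambda>x. x * _"] cong: if_cong)
  ultimately show ?thesis
    by (auto simp: invertible_mat_def inverts_mat_def N_def kernel_mat_def)
qed

lemma distinct_shortlex_between: "distinct (shortlex_between \<alpha> \<beta>)"
  and distinct_shortlex_upto: "distinct (shortlex_upto \<alpha>)"
proof -
  have "inj shortlex_nth"
    by (metis injI shortlex_rank_nth)
  then show "distinct (shortlex_between \<alpha> \<beta>)" "distinct (shortlex_upto \<alpha>)"
    unfolding shortlex_between_def shortlex_upto_def
    by (auto simp: distinct_map intro: inj_on_subset)
qed

text \<open>
  The row \<open>u\<close> and the entry \<open>K \<alpha> \<beta>\<close> consist of off-diagonal values of \<open>K\<close>, so the numerator vanishes.
  The scalar product sums over the indices of its second argument, whose dimension is that of the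
  inverse of the inner block; hence the appeal to invertibility.
\<close>

lemma verblunsky_upper_diagonal_kernel:
  assumes off: "\<And>x y. x \<noteq> y \<Longrightarrow> K x y = 0" and diag: "\<And>x. K x x \<noteq> 0"
    and less: "shortlex_less \<alpha> \<beta>"
  shows "verblunsky_upper K \<alpha> \<beta> = 0"
proof -
  let ?S = "shortlex_between \<alpha> \<beta>"
  have "invertible_mat (kernel_mat K ?S)"
    using distinct_shortlex_between off diag by (rule invertible_diagonal_kernel_mat)
  then obtain N where N: "mat_inverse (kernel_mat K ?S) = Some N"
    "N \<in> carrier_mat (length ?S) (length ?S)"
    by (rule mat_inverse_kernel_mat)
  have irrefl: "\<not> shortlex_less \<alpha> \<alpha>"
    by (simp add: shortlex_less_def)
  have "K \<alpha> (?S ! i) = 0" if "i < length ?S" for i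
    using nth_mem[OF that] irrefl unfolding shortlex_between(1) by (intro off) auto
  then have "scalar_prod (vec_of_list (map (K \<alpha>) ?S)) (N *\<^sub>v v) = 0" for v
    using N(2) by (auto simp: scalar_prod_def vec_of_list_index intro!: sum.neutral)
  moreover have "K \<alpha> \<beta> = 0"
    using less irrefl by (intro off) auto
  ultimately show ?thesis
    by (simp add: verblunsky_upper_def Let_def N(1))
qed


section \<open>Open cones and the geometric mean\<close>

text \<open>
  The measure of a subset of the sphere is the normalised volume of the part of the unit ball that
  projects radially onto it. For a cone this part is the intersection of the cone with the ball,
  and a non-empty open set has positive volume.
\<close>

lemma emeasure_sphere_measure_open_cone_pos:
  fixes C :: "(complex \<times> complex) set"
  assumes "open C" "C \<noteq> {}" and cone: "\<And>r x. r > 0 \<Longrightarrow> x \<in> C \<Longrightarrow> r *\<^sub>R x \<in> C" and "0 \<notin> C"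
  shows "emeasure sphere_measure (C \<inter> sphere 0 1) > 0"
proof -
  let ?B = "ball (0 :: complex \<times> complex) 1"
  have meas: "C \<inter> sphere 0 1 \<in> sets borel"
    using \<open>open C\<close> by simp
  have sub: "C \<subseteq> sgn -` (C \<inter> sphere 0 1)"
  proof
    fix x assume x: "x \<in> C"
    with \<open>0 \<notin> C\<close> have "x \<noteq> 0" by blast
    then show "x \<in> sgn -` (C \<inter> sphere 0 1)"
      using cone[OF _ x, of "inverse (norm x)"] by (simp add: norm_sgn) (simp add: sgn_div_norm)
  qed
  obtain x where x: "x \<in> C" using \<open>C \<noteq> {}\<close> by blast
  then have "norm x > 0" using \<open>0 \<notin> C\<close> by auto
  then have "(1 / (2 * norm x)) *\<^sub>R x \<in> ?B \<inter> C"
    using cone[OF _ x] by simp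
  then have "?B \<inter> C \<noteq> {}" by blast
  then have "emeasure lborel (?B \<inter> C) \<noteq> 0"
    using open_not_negligible[of "?B \<inter> C"] \<open>open C\<close>
    by (auto simp: negligible_iff_null_sets null_sets_def dest!: emeasure_completion)
  then have "0 < emeasure lborel (?B \<inter> C)"
    by (simp add: zero_less_iff_neq_zero)
  also have "\<dots> \<le> emeasure lborel (?B \<inter> sgn -` (C \<inter> sphere 0 1))"
    using sub measurable_sets_borel[OF sgn_measurable_prod meas]
    by (intro emeasure_mono) (auto intro!: sets.Int)
  finally have pos: "0 < emeasure lborel (?B \<inter> sgn -` (C \<inter> sphere 0 1))" .
  have "emeasure sphere_measure (C \<inter> sphere 0 1) =
      emeasure lborel (?B \<inter> sgn -` (C \<inter> sphere 0 1)) / emeasure lborel ?B"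
    using meas measurable_sets_borel[OF sgn_measurable_prod meas] unfolding sphere_measure_def
    by (simp add: emeasure_restrict_space emeasure_distr)
  with pos show ?thesis
    using emeasure_lborel_unit_ball(2)[where ?'a = "complex \<times> complex"]
    by (simp add: ennreal_zero_less_divide less_top)
qed

text \<open>
  The bound on \<open>w\<close> keeps the positive part of the logarithm integrable, and the zero set makes the
  negative part infinite.
\<close>

lemma ereal_integral_ln_eq_minus_infinity:
  assumes w: "w \<in> borel_measurable M" and "finite_measure M"
    and bound: "\<And>x. x \<in> space M \<Longrightarrow> w x \<le> B"
    and nonneg: "\<And>x. x \<in> space M \<Longrightarrow> 0 \<le> w x"
    and Z: "emeasure M {x \<in> space M. w x = 0} > 0"
  shows "ereal_integral M (\<lambda>x. ereal_ln (w x)) = -\<infinity>"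
proof -
  interpret finite_measure M by fact
  have "e2ennreal (ereal_ln (w x)) \<le> ennreal B" if "x \<in> space M" for x
  proof (cases "w x = 0")
    case False
    then have "ln (w x) \<le> B"
      using ln_bound[of "w x"] nonneg[OF that] bound[OF that] by simp
    then show ?thesis
      using False by (simp add: ereal_ln_def ennreal_leI)
  qed (simp add: ereal_ln_def e2ennreal_neg)
  then have "(\<integral>\<^sup>+x. e2ennreal (ereal_ln (w x)) \<partial>M) \<le> (\<integral>\<^sup>+x. ennreal B \<partial>M)"
    by (intro nn_integral_mono)
  also have "\<dots> < \<infinity>"
    by (simp add: emeasure_eq_measure ennreal_mult_less_top)
  finally have pos: "(\<integral>\<^sup>+x. e2ennreal (ereal_ln (w x)) \<partial>M) \<noteq> \<infinity>" by simp
  have "\<infinity> = (\<integral>\<^sup>+x. \<infinity> * indicator {x \<in> space M. w x = 0} x \<partial>M)"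
    using Z w by (subst nn_integral_cmult_indicator) (auto simp: ennreal_top_mult)
  also have "\<dots> \<le> (\<integral>\<^sup>+x. e2ennreal (- ereal_ln (w x)) \<partial>M)"
    by (intro nn_integral_mono) (auto simp: ereal_ln_def indicator_def)
  finally have neg: "(\<integral>\<^sup>+x. e2ennreal (- ereal_ln (w x)) \<partial>M) = \<infinity>"
    by (simp add: top_unique)
  show ?thesis
    using pos unfolding ereal_integral_def neg
    by (cases "\<integral>\<^sup>+x. e2ennreal (ereal_ln (w x)) \<partial>M") auto
qed


section \<open>The counterexample\<close>

theorem theorem7p6:
  shows "\<exists>(\<mu> :: (complex \<times> complex) measure) (w :: complex \<times> complex \<Rightarrow> real) (L :: real).
    w \<in> borel_measurable sphere_measure \<and>
    (\<forall>\<zeta> \<in> sphere 0 1. 0 \<le> w \<zeta>) \<and>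
    \<mu> = density sphere_measure (\<lambda>\<zeta>. ennreal (w \<zeta>)) \<and>
    prob_space \<mu> \<and>
    nontrivial_measure \<mu> \<and>
    has_shortlex_prod (\<lambda>\<alpha>. 1 - (cmod (verblunsky \<mu> (0, 0) \<alpha>))\<^sup>2) L \<and>
    ereal L \<noteq> ereal_exp (ereal_integral sphere_measure (\<lambda>\<zeta>. ereal_ln (w \<zeta>)))"
proof -
  interpret \<sigma>: prob_space sphere_measure by (rule prob_space_sphere_measure)
  \<comment> \<open>The condition \<open>0 < \<bar>\<zeta>\<^sub>1\<bar>\<close> keeps the axis \<open>\<zeta>\<^sub>1 = 0\<close>, where most monomials vanish, out of the support.\<close>
  define C :: "(complex \<times> complex) set" where "C = {\<zeta>. 0 < cmod (fst \<zeta>) \<and> cmod (fst \<zeta>) < cmod (snd \<zeta>)}"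
  define D :: "(complex \<times> complex) set" where "D = {\<zeta>. cmod (snd \<zeta>) < cmod (fst \<zeta>)}"
  define s where "s = measure sphere_measure (C \<inter> sphere 0 1)"
  define w :: "complex \<times> complex \<Rightarrow> real" where "w \<zeta> = indicator C \<zeta> / s" for \<zeta>
  define \<mu> where "\<mu> = density sphere_measure (\<lambda>\<zeta>. ennreal (w \<zeta>))"
  have "open C" "open D"
    unfolding C_def D_def by (intro open_Collect_conj open_Collect_less continuous_intros)+
  have "(1, 2) \<in> C" "(1, 0) \<in> D"
    by (auto simp: C_def D_def)
  then have "C \<noteq> {}" "D \<noteq> {}" by auto
  have Cpos: "emeasure sphere_measure (C \<inter> sphere 0 1) > 0"
    using \<open>C \<noteq> {}\<close> by (intro emeasure_sphere_measure_open_cone_pos \<open>open C\<close>) (auto simp: C_def)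
  have Dpos: "emeasure sphere_measure (D \<inter> sphere 0 1) > 0"
    using \<open>D \<noteq> {}\<close> by (intro emeasure_sphere_measure_open_cone_pos \<open>open D\<close>) (auto simp: D_def)
  have spos: "s > 0"
    using Cpos by (simp add: s_def \<sigma>.emeasure_eq_measure)
  have "w \<in> borel_measurable borel"
    unfolding w_def using \<open>open C\<close> by (intro borel_measurable_divide borel_measurable_indicator) auto
  then have wm: "w \<in> borel_measurable sphere_measure"
    by (rule borel_measurable_sphere_measureI)
  have w0: "0 \<le> w \<zeta>" for \<zeta>
    using spos by (simp add: w_def)
  have Cs: "C \<inter> sphere 0 1 \<in> sets sphere_measure"
    using \<open>open C\<close> by (auto simp: sets_restrict_space)
  have prob: "prob_space \<mu>"
  proof
    have "emeasure \<mu> (space \<mu>) = (\<integral>\<^sup>+\<zeta>. ennreal (w \<zeta>) \<partial>sphere_measure)"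
      using wm unfolding \<mu>_def space_density
      by (subst emeasure_density[OF _ sets.top]) (auto intro!: nn_integral_cong)
    also have "\<dots> = (\<integral>\<^sup>+\<zeta>. ennreal (1 / s) * indicator (C \<inter> sphere 0 1) \<zeta> \<partial>sphere_measure)"
      by (intro nn_integral_cong) (auto simp: w_def indicator_def)
    also have "\<dots> = ennreal (1 / s) * ennreal s"
      using Cs by (simp add: nn_integral_cmult_indicator s_def \<sigma>.emeasure_eq_measure)
    also have "\<dots> = 1"
      using spos by (simp flip: ennreal_mult')
    finally show "emeasure \<mu> (space \<mu>) = 1" .
  qed
  have inv: "torus_invariant w"
    by (auto simp: torus_invariant_def torus_rotation_def w_def C_def indicator_def norm_mult)
  have off: "moment \<mu> \<alpha> \<beta> = 0" if "\<alpha> \<noteq> \<beta>" for \<alpha> \<beta>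
    unfolding \<mu>_def using wm w0 inv that by (intro moment_off_diagonal_eq_0) auto
  have diag: "moment \<mu> \<alpha> \<alpha> \<noteq> 0" for \<alpha>
    unfolding \<mu>_def
    by (rule moment_diagonal_ne_0[OF wm prob[unfolded \<mu>_def]])
      (auto simp: w_def C_def indicator_def split: if_splits)
  have nontriv: "nontrivial_measure \<mu>"
    unfolding nontrivial_measure_def
    by (intro allI invertible_diagonal_kernel_mat distinct_shortlex_upto off diag)
  have "verblunsky \<mu> \<alpha> \<beta> = 0" for \<alpha> \<beta>
    unfolding verblunsky_def using verblunsky_upper_diagonal_kernel[of "moment \<mu>", OF off diag] by simp
  then have prod: "has_shortlex_prod (\<lambda>\<alpha>. 1 - (cmod (verblunsky \<mu> (0, 0) \<alpha>))\<^sup>2) 1"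
    by (simp add: has_shortlex_prod_def)
  have "emeasure sphere_measure {\<zeta> \<in> space sphere_measure. w \<zeta> = 0} > 0"
  proof (rule less_le_trans[OF Dpos], rule emeasure_mono)
    show "D \<inter> sphere 0 1 \<subseteq> {\<zeta> \<in> space sphere_measure. w \<zeta> = 0}"
      by (auto simp: w_def C_def D_def)
    show "{\<zeta> \<in> space sphere_measure. w \<zeta> = 0} \<in> sets sphere_measure"
      using wm by (rule borel_measurable_eq) simp
  qed
  then have "ereal_integral sphere_measure (\<lambda>\<zeta>. ereal_ln (w \<zeta>)) = -\<infinity>"
    using w0 spos
    by (intro ereal_integral_ln_eq_minus_infinity[where B = "1 / s"] wm \<sigma>.finite_measure_axioms)
      (auto simp: w_def indicator_def)
  then have "ereal 1 \<noteq> ereal_exp (ereal_integral sphere_measure (\<lambda>\<zeta>. ereal_ln (w \<zeta>)))"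
    by (simp add: ereal_exp_def)
  with wm w0 prob nontriv prod show ?thesis
    unfolding \<mu>_def by blast
qed

end
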